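(* For every $n\ge 1$, the geodesic distance $d$ on real hyperbolic space $H_{\mathbb R}^n$ is a hypermetric.
   Context: On $\mathbb R^{n+1}$ consider the form $\langle z,w\rangle=-z^0w^0+z^1w^1+\cdots+z^nw^n$. Real hyperbolic space $H_{\mathbb R}^n$ is the image in projective space $P_{\mathbb R}^n$ of the set of negative vectors $\{x\in\mathbb R^{n+1}:\langle x,x\rangle<0\}$; the same notation is used for a negative vector and its class. The geodesic distance is given by $\cosh d(x,y)=\frac{|\langle x,y\rangle|}{(\langle x,x\rangle\langle y,y\rangle)^{1/2}}$. A semimetric $d$ on a set $X$ is a hypermetric if for every finite subset $\{x_1,\dots,x_m\}$ of $X$ and all integers $t_1,\dots,t_m$ with $\sum_{i=1}^m t_i=1$ one has $\sum_{i,j=1}^m t_it_j\,d(x_i,x_j)\le 0$. *)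

theory Defs
  imports "HOL-Analysis.Analysis"
begin

(* R^(n+1) is modelled as real \<times> (real^'n) with n = CARD('n) \<ge> 1: the first component is the
   coordinate z^0, the second one is (z^1, ..., z^n). *)

definition lorentz :: "real \<times> (real ^ 'n) \<Rightarrow> real \<times> (real ^ 'n) \<Rightarrow> real"
  where "lorentz z w = - (fst z * fst w) + (\<Sum>i\<in>UNIV. snd z $ i * snd w $ i)"

quotient_type (overloaded) 'n projective_space =
  "real \<times> (real ^ ('n::finite))" / partial: "\<lambda>x y. x \<noteq> 0 \<and> y \<noteq> 0 \<and> (\<exists>c::real. c \<noteq> 0 \<and> y = c *\<^sub>R x)"
  morphisms rep_projective proj_class
proof (rule part_equivpI)
  have "(1, 0) \<noteq> (0 :: real \<times> (real ^ 'n))" by (simp add: zero_prod_def)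
  then show "\<exists>x::real \<times> (real ^ 'n). x \<noteq> 0 \<and> x \<noteq> 0 \<and> (\<exists>c::real. c \<noteq> 0 \<and> x = c *\<^sub>R x)"
    by (intro exI[of _ "(1, 0)"] conjI exI[of _ "1::real"]) simp_all
  show "symp (\<lambda>x y::real \<times> (real ^ 'n). x \<noteq> 0 \<and> y \<noteq> 0 \<and> (\<exists>c::real. c \<noteq> 0 \<and> y = c *\<^sub>R x))"
  proof (rule sympI, elim conjE exE, intro conjI)
    fix x y :: "real \<times> (real ^ 'n)" and c :: real
    assume "c \<noteq> 0" "y = c *\<^sub>R x"
    then show "\<exists>c::real. c \<noteq> 0 \<and> x = c *\<^sub>R y"
      by (intro exI[of _ "inverse c"]) simp
  qed
  show "transp (\<lambda>x y::real \<times> (real ^ 'n). x \<noteq> 0 \<and> y \<noteq> 0 \<and> (\<exists>c::real. c \<noteq> 0 \<and> y = c *\<^sub>R x))"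
  proof (rule transpI, elim conjE exE, intro conjI)
    fix x y z :: "real \<times> (real ^ 'n)" and c d :: real
    assume "c \<noteq> 0" "y = c *\<^sub>R x" "d \<noteq> 0" "z = d *\<^sub>R y"
    then show "\<exists>c::real. c \<noteq> 0 \<and> z = c *\<^sub>R x"
      by (intro exI[of _ "d * c"]) simp
  qed
qed

definition hyperbolic_space :: "('n::finite) projective_space set"
  where "hyperbolic_space = proj_class ` {x. lorentz x x < 0}"

lemma lorentz_scaleR [simp]:
  "lorentz (c *\<^sub>R x) y = c * lorentz x y" "lorentz x (c *\<^sub>R y) = c * lorentz x y"
  by (simp_all add: lorentz_def algebra_simps sum_distrib_left)

(* The formula is invariant under rescaling either argument, hence descends to projective space;
   only its values on hyperbolic_space are meaningful (there the argument of arcosh is at least 1,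
   see cosh_geodesic_dist below). *)
lift_definition geodesic_dist :: "('n::finite) projective_space \<Rightarrow> 'n projective_space \<Rightarrow> real"
  is "\<lambda>x y. arcosh (\<bar>lorentz x y\<bar> / sqrt (lorentz x x * lorentz y y))"
proof -
  fix x x' y y' :: "real \<times> (real ^ 'n)"
  assume "x \<noteq> 0 \<and> x' \<noteq> 0 \<and> (\<exists>c::real. c \<noteq> 0 \<and> x' = c *\<^sub>R x)"
    and "y \<noteq> 0 \<and> y' \<noteq> 0 \<and> (\<exists>c::real. c \<noteq> 0 \<and> y' = c *\<^sub>R y)"
  then obtain c d where cd: "c \<noteq> 0" "x' = c *\<^sub>R x" "d \<noteq> 0" "y' = d *\<^sub>R y"
    by blast
  have "lorentz x' x' * lorentz y' y' = (c * d)\<^sup>2 * (lorentz x x * lorentz y y)"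
    by (simp add: cd power2_eq_square)
  moreover have "\<bar>lorentz x' y'\<bar> = \<bar>c * d\<bar> * \<bar>lorentz x y\<bar>"
    by (simp add: cd abs_mult)
  ultimately have "\<bar>lorentz x' y'\<bar> / sqrt (lorentz x' x' * lorentz y' y') =
      \<bar>lorentz x y\<bar> / sqrt (lorentz x x * lorentz y y)"
    using cd(1,3) by (simp only: real_sqrt_mult real_sqrt_abs) simp
  then show "arcosh (\<bar>lorentz x y\<bar> / sqrt (lorentz x x * lorentz y y)) =
      arcosh (\<bar>lorentz x' y'\<bar> / sqrt (lorentz x' x' * lorentz y' y'))"
    by simp
qed

lemma lorentz_inner: "lorentz z w = snd z \<bullet> snd w - fst z * fst w"
  by (simp add: lorentz_def inner_vec_def)

lemma lorentz_reverse_cauchy_schwarz: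
  assumes "lorentz x x < 0" "lorentz y y < 0"
  shows "sqrt (lorentz x x * lorentz y y) \<le> \<bar>lorentz x y\<bar>"
proof -
  define a b u v where "a = \<bar>fst x\<bar>" and "b = \<bar>fst y\<bar>" and "u = norm (snd x)" and "v = norm (snd y)"
  have xx: "lorentz x x = u\<^sup>2 - a\<^sup>2" and yy: "lorentz y y = v\<^sup>2 - b\<^sup>2"
    by (simp_all add: lorentz_inner a_def b_def u_def v_def power2_norm_eq_inner)
      (simp_all add: power2_eq_square)
  have nn: "0 \<le> a" "0 \<le> b" "0 \<le> u" "0 \<le> v"
    by (simp_all add: a_def b_def u_def v_def)
  have "u < a" "v < b"
    using assms nn by (simp_all add: xx yy power2_less_imp_less)
  then have uv: "u * v \<le> a * b"
    using nn by (intro mult_mono) auto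
  have "a * b - u * v \<le> \<bar>lorentz x y\<bar>"
  proof -
    have "\<bar>snd x \<bullet> snd y\<bar> \<le> u * v"
      unfolding u_def v_def by (rule Cauchy_Schwarz_ineq2)
    moreover have "\<bar>fst x * fst y\<bar> = a * b"
      unfolding a_def b_def by (rule abs_mult)
    ultimately show ?thesis
      unfolding lorentz_inner by linarith
  qed
  moreover have "sqrt (lorentz x x * lorentz y y) \<le> a * b - u * v"
  proof (rule real_le_lsqrt)
    have "0 \<le> (a * v - b * u)\<^sup>2" by simp
    then show "lorentz x x * lorentz y y \<le> (a * b - u * v)\<^sup>2"
      by (simp add: xx yy power2_eq_square algebra_simps)
  qed (use uv in auto)
  ultimately show ?thesis by linarith
qed

lemma cosh_geodesic_dist:
  assumes "lorentz x x < 0" "lorentz y y < 0"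
  shows "cosh (geodesic_dist (proj_class x) (proj_class y)) =
      \<bar>lorentz x y\<bar> / sqrt (lorentz x x * lorentz y y)"
    and "geodesic_dist (proj_class x) (proj_class y) \<ge> 0"
proof -
  have ne: "x \<noteq> 0" "y \<noteq> 0" using assms by (auto simp: lorentz_def)
  have r: "z \<noteq> 0 \<and> z \<noteq> 0 \<and> (\<exists>c::real. c \<noteq> 0 \<and> z = c *\<^sub>R z)" if "z \<noteq> 0" for z :: "real \<times> (real ^ 'n)"
    using that by (intro conjI exI[of _ "1::real"]) simp_all
  have d: "geodesic_dist (proj_class x) (proj_class y) =
      arcosh (\<bar>lorentz x y\<bar> / sqrt (lorentz x x * lorentz y y))"
    by (rule geodesic_dist.abs_eq[OF r[OF ne(1)] r[OF ne(2)]])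
  have "0 < lorentz x x * lorentz y y"
    using assms by (rule mult_neg_neg)
  then have ge: "1 \<le> \<bar>lorentz x y\<bar> / sqrt (lorentz x x * lorentz y y)"
    using lorentz_reverse_cauchy_schwarz[OF assms] by simp
  show "cosh (geodesic_dist (proj_class x) (proj_class y)) =
      \<bar>lorentz x y\<bar> / sqrt (lorentz x x * lorentz y y)"
    unfolding d by (rule cosh_arcosh_real[OF ge])
  show "geodesic_dist (proj_class x) (proj_class y) \<ge> 0"
    unfolding d by (rule arcosh_nonneg_real[OF ge])
qed

definition semimetric_on :: "'a set \<Rightarrow> ('a \<Rightarrow> 'a \<Rightarrow> real) \<Rightarrow> bool"
  where "semimetric_on X d \<longleftrightarrow>
    (\<forall>x\<in>X. d x x = 0) \<and>
    (\<forall>x\<in>X. \<forall>y\<in>X. 0 \<le> d x y \<and> d x y = d y x) \<and>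
    (\<forall>x\<in>X. \<forall>y\<in>X. \<forall>z\<in>X. d x z \<le> d x y + d y z)"

definition hypermetric_on :: "'a set \<Rightarrow> ('a \<Rightarrow> 'a \<Rightarrow> real) \<Rightarrow> bool"
  where "hypermetric_on X d \<longleftrightarrow> semimetric_on X d \<and>
    (\<forall>S t. finite S \<longrightarrow> S \<subseteq> X \<longrightarrow> (\<Sum>x\<in>S. t x) = (1::int) \<longrightarrow>
      (\<Sum>x\<in>S. \<Sum>y\<in>S. of_int (t x) * of_int (t y) * d x y) \<le> 0)"

end

theory Submission imports Defs begin

text \<open>The hyperbolic distance is, up to a constant factor, the measure of the set of hyperplanes that
  separate two points (a Crofton formula). A distance of this kind is an average of cut
  semimetrics: for one hyperplane, let \<open>a\<close> be the sum of those weights \<open>t\<^sub>i\<close> whose points lie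
  on a chosen side of it. The contribution of this hyperplane to \<open>\<Sum>t\<^sub>i t\<^sub>j d(x\<^sub>i, x\<^sub>j)\<close> is \<open>2 a (1 - a)\<close>,
  which is not positive because \<open>a\<close> is an integer. Integrating over all hyperplanes gives the
  hypermetric inequality (\<open>sum_cut_measure_nonpos\<close>), and the triangle inequality is the statement
  that a hyperplane separating \<open>x\<close> from \<open>z\<close> separates \<open>x\<close> from \<open>y\<close> or \<open>y\<close> from \<open>z\<close>.
  
  A hyperplane of hyperbolic space is the orthogonal complement of a vector \<open>w\<close> with
  \<open>\<langle>w, w\<rangle> > 0\<close>, determined up to a scalar. An invariant measure on hyperplanes is therefore obtained
  by restricting Lebesgue measure on the ambient space to the shell \<open>0 < \<langle>w, w\<rangle> < 1\<close>: the isometries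
  of the form preserve the shell, and they preserve Lebesgue measure. Only reflections are
  needed, and these are linear involutions (\<open>lborel_linear_involution\<close>).
  
  The Crofton formula \<open>crofton_eq_distance\<close> then follows without computing any volume. Two
  reflections carry a pair of points to any other pair at the same distance, so the measure \<open>F(s)\<close> of
  the hyperplanes separating two points at distance \<open>s\<close> is well defined (\<open>crofton_cong\<close>). Along a
  geodesic the sets of separating hyperplanes add up disjointly (\<open>crofton_additive\<close>), so \<open>F\<close> is
  additive; being nonnegative and finite it is linear, and its slope is positive since some nonempty
  open set of hyperplanes separates two points at distance \<open>1\<close>.\<close>

section \<open>Linear involutions preserve Lebesgue measure\<close>

text \<open>The image measure is translation invariant, hence a multiple of Lebesgue measure, and on a set \<open>B\<close>
  invariant under the involution the factor must be \<open>1\<close>. The proof is the usual uniqueness argument for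
  Haar measure: Fubini and translations turn \<open>\<lambda>(f\<inverse> A) \<lambda>(B)\<close> into \<open>\<lambda>(A) \<lambda>(- f\<inverse> B)\<close>, and
  \<open>B\<close> can be chosen so that \<open>- f\<inverse> B = B\<close>.\<close>
lemma lborel_linear_involution:
  fixes f :: "'a::euclidean_space \<Rightarrow> 'a"
  assumes lin: "linear f" and inv: "\<And>x. f (f x) = x" and A: "A \<in> sets borel"
  shows "emeasure lborel (f -` A) = emeasure lborel A"
proof -
  have cont: "continuous_on UNIV f"
    using lin by (simp add: linear_continuous_on linear_linear)
  have fm [measurable]: "f \<in> borel_measurable borel"
    using cont by (rule borel_measurable_continuous_onI)
  have fadd: "f (x + y) = f x + f y" for x y by (rule linear_add[OF lin])
  have fneg: "f (- x) = - f x" for x by (rule linear_neg[OF lin])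
  \<comment> \<open>Symmetric and, because \<open>f\<close> is an involution, mapped to itself; bounded and a neighbourhood
    of \<open>0\<close>, so of finite positive measure and thus cancellable at the end.\<close>
  define B where "B = ball 0 1 \<inter> f -` ball (0::'a) 1"
  have openB: "open B"
    unfolding B_def by (intro open_Int open_ball open_vimage cont)
  then have [measurable]: "B \<in> sets borel" by simp
  have B0: "0 \<in> B" by (simp add: B_def linear_0[OF lin])
  have Bsym: "- f x \<in> B \<longleftrightarrow> x \<in> B" for x
    by (auto simp: B_def fneg inv)
  have "bounded B" unfolding B_def by (simp add: bounded_Int)
  then have Bfin: "emeasure lborel B \<noteq> \<infinity>"
    using emeasure_bounded_finite by fastforce
  have Bpos: "emeasure lborel B \<noteq> 0"
  proof
    assume "emeasure lborel B = 0"
    then have "B \<in> null_sets lborel" by auto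
    then have "negligible B" by (simp add: null_sets_completionI negligible_iff_null_sets)
    then show False using open_not_negligible[OF openB] B0 by auto
  qed
  note A [measurable]
  have shift: "(\<integral>\<^sup>+y. g (y + a) \<partial>lborel) = (\<integral>\<^sup>+y. g y \<partial>lborel)"
    if [measurable]: "g \<in> borel_measurable borel" for g :: "'a \<Rightarrow> ennreal" and a
    by (subst (2) lborel_distr_plus[symmetric, of a]) (simp add: nn_integral_distr add.commute)
  have fA [measurable]: "f -` A \<in> sets borel"
    using measurable_sets[OF fm A] by simp
  have "emeasure lborel (f -` A) * emeasure lborel B
      = (\<integral>\<^sup>+x. indicator A (f x) * (\<integral>\<^sup>+y. indicator B y \<partial>lborel) \<partial>lborel)"
  proof -
    have "(\<integral>\<^sup>+x. indicator A (f x) \<partial>lborel) = (\<integral>\<^sup>+x. indicator (f -` A) x \<partial>lborel)"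
      by (intro nn_integral_cong) (simp add: indicator_def)
    also have "\<dots> = emeasure lborel (f -` A)" by simp
    finally show ?thesis by (simp add: nn_integral_multc)
  qed
  also have "\<dots> = (\<integral>\<^sup>+x. indicator A (f x) * (\<integral>\<^sup>+y. indicator B (y + - f x) \<partial>lborel) \<partial>lborel)"
    by (subst shift) auto
  also have "\<dots> = (\<integral>\<^sup>+x. (\<integral>\<^sup>+y. indicator A (f x) * indicator B (y + - f x) \<partial>lborel) \<partial>lborel)"
    by (intro nn_integral_cong nn_integral_cmult[symmetric]) measurable
  also have "\<dots> = (\<integral>\<^sup>+y. (\<integral>\<^sup>+x. indicator A (f x) * indicator B (y + - f x) \<partial>lborel) \<partial>lborel)"
    by (rule lborel_pair.Fubini'[symmetric]) measurable
  also have "\<dots> = (\<integral>\<^sup>+y. (\<integral>\<^sup>+x. indicator A (f (x + f y)) * indicator B (y + - f (x + f y)) \<partial>lborel) \<partial>lborel)"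
    by (subst shift) auto
  also have "\<dots> = (\<integral>\<^sup>+y. (\<integral>\<^sup>+x. indicator A (y + f x) * indicator B x \<partial>lborel) \<partial>lborel)"
    by (intro nn_integral_cong) (simp add: fadd inv indicator_def Bsym add.commute)
  also have "\<dots> = (\<integral>\<^sup>+x. (\<integral>\<^sup>+y. indicator A (y + f x) * indicator B x \<partial>lborel) \<partial>lborel)"
    by (rule lborel_pair.Fubini') measurable
  also have "\<dots> = (\<integral>\<^sup>+x. (\<integral>\<^sup>+y. indicator A (y + f x) \<partial>lborel) * indicator B x \<partial>lborel)"
    by (intro nn_integral_cong nn_integral_multc) measurable
  also have "\<dots> = emeasure lborel A * emeasure lborel B"
    by (subst shift) (auto simp: nn_integral_cmult)
  finally show ?thesis using Bpos Bfin
    by (metis ennreal_mult_cancel_left mult.commute infinity_ennreal_def)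
qed

section \<open>Nonnegative additive functions\<close>

text \<open>Additivity and nonnegativity make \<open>F\<close> monotone and squeeze \<open>n F(s) = F(n s)\<close> between the values of
  \<open>F\<close> at the integers next to \<open>n s\<close>. So \<open>F(s)\<close> and \<open>s F(1)\<close> differ by at most \<open>F(1) / n\<close> for every \<open>n\<close>.\<close>
lemma additive_nonneg_linear:
  fixes F :: "real \<Rightarrow> real"
  assumes add: "\<And>s t. 0 \<le> s \<Longrightarrow> 0 \<le> t \<Longrightarrow> F (s + t) = F s + F t"
    and nonneg: "\<And>s. 0 \<le> s \<Longrightarrow> 0 \<le> F s" and s: "0 \<le> s"
  shows "F s = s * F 1"
proof -
  have mult: "F (real n * t) = real n * F t" if "0 \<le> t" for n t
  proof (induction n)
    case 0
    show ?case using add[of 0 0] by simp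
  next
    case (Suc n)
    then show ?case using add[of t "real n * t"] that by (simp add: algebra_simps)
  qed
  have bound: "real n * \<bar>F s - s * F 1\<bar> \<le> F 1" for n
  proof -
    define k where "k = nat \<lfloor>real n * s\<rfloor>"
    have k: "real k \<le> real n * s" "real n * s \<le> real (Suc k)"
      unfolding k_def using s by (auto simp: zero_le_mult_iff) linarith
    have "F (real n * s) = F (real k) + F (real n * s - real k)"
      using add[of "real k" "real n * s - real k"] k by simp
    then have lo: "real k * F 1 \<le> real n * F s"
      using nonneg[of "real n * s - real k"] k mult[of 1 k] mult[OF s, of n] by simp
    have "F (real (Suc k)) = F (real n * s) + F (real (Suc k) - real n * s)"
      using add[of "real n * s" "real (Suc k) - real n * s"] k s by simp
    then have hi: "real n * F s \<le> (real k + 1) * F 1"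
      using nonneg[of "real (Suc k) - real n * s"] k mult[of 1 "Suc k"] mult[OF s, of n]
      by (simp add: add.commute)
    have F1: "0 \<le> F 1" by (rule nonneg) simp
    have "real k * F 1 \<le> (real n * s) * F 1" "(real n * s) * F 1 \<le> (real k + 1) * F 1"
      using k F1 by (auto intro!: mult_right_mono)
    then have "\<bar>real n * F s - real n * s * F 1\<bar> \<le> F 1"
      using lo hi by (simp add: algebra_simps abs_le_iff)
    moreover have "real n * F s - real n * s * F 1 = real n * (F s - s * F 1)"
      by (simp add: algebra_simps)
    ultimately show ?thesis by (simp add: abs_mult)
  qed
  show ?thesis
  proof (rule ccontr)
    assume "F s \<noteq> s * F 1"
    then have "0 < \<bar>F s - s * F 1\<bar>" by simp
    from reals_Archimedean3[OF this, rule_format, of "F 1"] bound show False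
      by (meson not_le)
  qed
qed

section \<open>Cut measures satisfy the hypermetric inequality\<close>

text \<open>With \<open>a\<close> the total weight of the points satisfying \<open>P\<close>, the sum is \<open>2 a (1 - a)\<close>, and no integer lies
  strictly between \<open>0\<close> and \<open>1\<close>.\<close>
lemma sum_cut_nonpos:
  fixes t :: "'a \<Rightarrow> int" and P :: "'a \<Rightarrow> bool"
  assumes "finite S" and t: "(\<Sum>x\<in>S. t x) = 1"
  shows "(\<Sum>x\<in>S. \<Sum>y\<in>S. t x * t y * of_bool (P x \<noteq> P y)) \<le> 0"
proof -
  define a where "a = (\<Sum>x\<in>S. t x * of_bool (P x))"
  have b: "(\<Sum>x\<in>S. t x * of_bool (\<not> P x)) = 1 - a"
    unfolding a_def t[symmetric] sum_subtractf[symmetric] by (intro sum.cong) auto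
  have "(\<Sum>x\<in>S. \<Sum>y\<in>S. t x * t y * of_bool (P x \<noteq> P y))
      = (\<Sum>x\<in>S. \<Sum>y\<in>S. (t x * of_bool (P x)) * (t y * of_bool (\<not> P y))
          + (t x * of_bool (\<not> P x)) * (t y * of_bool (P y)))"
    by (intro sum.cong) auto
  also have "\<dots> = a * (1 - a) + (1 - a) * a"
    by (simp add: sum.distrib sum_product[symmetric] b a_def[symmetric])
  also have "\<dots> = 2 * (a * (1 - a))" by simp
  also have "a * (1 - a) \<le> 0"
    by (cases "a \<le> 0") (auto simp: mult_le_0_iff)
  finally show ?thesis by simp
qed

text \<open>Every \<open>w\<close> induces a cut of \<open>S\<close> by \<open>\<lambda>x. P x w\<close>; the inequality for single cuts is integrated over \<open>w\<close>.\<close>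
lemma sum_cut_measure_nonpos:
  fixes t :: "'a \<Rightarrow> int" and P :: "'a \<Rightarrow> 'b \<Rightarrow> bool"
  assumes S: "finite S" and t: "(\<Sum>x\<in>S. t x) = 1"
    and fin: "\<And>x y. x \<in> S \<Longrightarrow> y \<in> S \<Longrightarrow> {w \<in> D. P x w \<noteq> P y w} \<in> fmeasurable M"
  shows "(\<Sum>x\<in>S. \<Sum>y\<in>S. of_int (t x) * of_int (t y) * measure M {w \<in> D. P x w \<noteq> P y w}) \<le> 0"
proof -
  let ?C = "\<lambda>x y. {w \<in> D. P x w \<noteq> P y w}"
  have int: "integrable M (indicat_real (?C x y))" if "x \<in> S" "y \<in> S" for x y
    using fin[OF that] by (simp add: fmeasurable_def integrable_indicator_iff)
  have "(\<Sum>x\<in>S. \<Sum>y\<in>S. of_int (t x) * of_int (t y) * measure M (?C x y))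
      = (\<Sum>x\<in>S. \<Sum>y\<in>S. of_int (t x) * of_int (t y) * (\<integral>w. indicat_real (?C x y) w \<partial>M))"
    using fin by (intro sum.cong refl) (simp add: fmeasurable_def Int_absorb2 sets.sets_into_space)
  also have "\<dots> = (\<integral>w. (\<Sum>x\<in>S. \<Sum>y\<in>S. of_int (t x) * of_int (t y) * indicat_real (?C x y) w) \<partial>M)"
    using int by simp
  also have "\<dots> \<le> (\<integral>w. 0 \<partial>M)"
  proof (rule integral_mono)
    show "integrable M (\<lambda>w. \<Sum>x\<in>S. \<Sum>y\<in>S. of_int (t x) * of_int (t y) * indicat_real (?C x y) w)"
      using int by simp
    show "integrable M (\<lambda>w. 0 :: real)" by simp
    fix w
    define N where "N = (\<Sum>x\<in>S. \<Sum>y\<in>S. t x * t y * of_bool (P x w \<noteq> P y w))"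
    have "(\<Sum>x\<in>S. \<Sum>y\<in>S. of_int (t x) * of_int (t y) * indicat_real (?C x y) w)
        = of_bool (w \<in> D) * of_int N"
      unfolding N_def by (auto simp: indicator_def intro!: sum.cong)
    also have "\<dots> \<le> 0"
      using sum_cut_nonpos[OF S t, of "\<lambda>x. P x w"] unfolding N_def[symmetric] by simp
    finally show "(\<Sum>x\<in>S. \<Sum>y\<in>S. of_int (t x) * of_int (t y) * indicat_real (?C x y) w) \<le> 0" .
  qed
  finally show ?thesis by simp
qed

section \<open>The Lorentz form and its reflections\<close>

lemma lorentz_sym: "lorentz x y = lorentz y x"
  by (simp add: lorentz_inner inner_commute mult.commute)

lemma lorentz_diff_left: "lorentz (x - y) z = lorentz x z - lorentz y z"
  by (simp add: lorentz_inner inner_diff_left algebra_simps)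

lemma lorentz_diff_right: "lorentz z (x - y) = lorentz z x - lorentz z y"
  by (simp add: lorentz_inner inner_diff_right algebra_simps)

lemma lorentz_add_left: "lorentz (x + y) z = lorentz x z + lorentz y z"
  by (simp add: lorentz_inner inner_add_left algebra_simps)

lemma lorentz_add_right: "lorentz z (x + y) = lorentz z x + lorentz z y"
  by (simp add: lorentz_inner inner_add_right algebra_simps)

lemma continuous_on_lorentz [continuous_intros]:
  fixes f g :: "'a::topological_space \<Rightarrow> real \<times> (real ^ 'n::finite)"
  assumes "continuous_on S f" "continuous_on S g"
  shows "continuous_on S (\<lambda>w. lorentz (f w) (g w))"
  unfolding lorentz_inner by (intro continuous_intros assms)

lemma borel_measurable_lorentz [measurable (raw)]:
  fixes f g :: "'a \<Rightarrow> real \<times> (real ^ 'n::finite)"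
  assumes f: "f \<in> borel_measurable M" and g: "g \<in> borel_measurable M"
  shows "(\<lambda>w. lorentz (f w) (g w)) \<in> borel_measurable M"
  using borel_measurable_continuous_Pair[OF f g, of lorentz]
  by (simp add: continuous_intros)

definition lorentz_reflection ::
    "real \<times> (real ^ 'n) \<Rightarrow> real \<times> (real ^ 'n) \<Rightarrow> real \<times> (real ^ 'n::finite)"
  where "lorentz_reflection v x = x - (2 * lorentz v x / lorentz v v) *\<^sub>R v"

lemma linear_lorentz_reflection: "linear (lorentz_reflection v)"
  by (rule linearI)
    (simp_all add: lorentz_reflection_def lorentz_add_right distrib_left add_divide_distrib
      scaleR_add_left scaleR_diff_right mult.left_commute)

lemma lorentz_reflection_isometry:
  assumes "lorentz v v \<noteq> 0"
  shows "lorentz (lorentz_reflection v x) (lorentz_reflection v y) = lorentz x y"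
  using assms
  by (simp add: lorentz_reflection_def lorentz_diff_left lorentz_diff_right lorentz_sym[of x v])

lemma lorentz_reflection_involution:
  assumes "lorentz v v \<noteq> 0"
  shows "lorentz_reflection v (lorentz_reflection v x) = x"
proof -
  have "lorentz v (lorentz_reflection v x) = - lorentz v x"
    using assms by (simp add: lorentz_reflection_def lorentz_diff_right)
  then show ?thesis by (simp add: lorentz_reflection_def)
qed

section \<open>The upper sheet of the hyperboloid\<close>

text \<open>The hyperboloid model: every negative line meets the upper sheet in exactly one point. Choosing
  this point makes the sign of \<open>\<langle>x, w\<rangle>\<close>, the side of the hyperplane orthogonal to \<open>w\<close> on which \<open>x\<close> lies, meaningful.\<close>
definition upper_sheet :: "(real \<times> (real ^ 'n::finite)) set"
  where "upper_sheet = {x. 0 < fst x \<and> lorentz x x = -1}"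

lemma upper_sheet_fst: "x \<in> upper_sheet \<Longrightarrow> fst x ^ 2 = 1 + norm (snd x) ^ 2"
  unfolding power2_norm_eq_inner by (simp add: upper_sheet_def lorentz_inner power2_eq_square)

lemma upper_sheet_norm_less:
  assumes "x \<in> upper_sheet"
  shows "norm (snd x) < fst x"
proof (rule power2_less_imp_less)
  show "norm (snd x) ^ 2 < fst x ^ 2" using upper_sheet_fst[OF assms] by simp
  show "0 \<le> fst x" using assms by (simp add: upper_sheet_def)
qed

lemma upper_sheet_lorentz_neg:
  assumes "x \<in> upper_sheet" "y \<in> upper_sheet"
  shows "lorentz x y < 0"
proof -
  have "snd x \<bullet> snd y \<le> norm (snd x) * norm (snd y)" by (rule norm_cauchy_schwarz)
  also have "\<dots> < fst x * fst y"
    using upper_sheet_norm_less[OF assms(1)] upper_sheet_norm_less[OF assms(2)]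
    by (intro mult_strict_mono') auto
  finally show ?thesis by (simp add: lorentz_inner)
qed

lemma upper_sheet_lorentz_le:
  assumes "x \<in> upper_sheet" "y \<in> upper_sheet"
  shows "lorentz x y \<le> -1"
proof -
  have "lorentz x x = -1" "lorentz y y = -1" using assms by (simp_all add: upper_sheet_def)
  then have "1 \<le> \<bar>lorentz x y\<bar>" using lorentz_reverse_cauchy_schwarz[of x y] by simp
  then show ?thesis using upper_sheet_lorentz_neg[OF assms] by linarith
qed

text \<open>The equality case of the reversed Cauchy--Schwarz inequality. Squaring \<open>fst x * fst y = 1 + u \<bullet> v\<close>, where
  \<open>u\<close> and \<open>v\<close> are the spatial parts of \<open>x\<close> and \<open>y\<close>, gives
  \<open>\<parallel>u - v\<parallel>\<^sup>2 + (\<parallel>u\<parallel>\<^sup>2 \<parallel>v\<parallel>\<^sup>2 - (u \<bullet> v)\<^sup>2) = 0\<close>, a sum of two nonnegative terms.\<close>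
lemma upper_sheet_lorentz_eqD:
  assumes x: "x \<in> upper_sheet" and y: "y \<in> upper_sheet" and eq: "lorentz x y = -1"
  shows "x = y"
proof -
  have "fst x * fst y = 1 + snd x \<bullet> snd y"
    using eq by (simp add: lorentz_inner)
  then have "(fst x * fst y)\<^sup>2 = (1 + snd x \<bullet> snd y)\<^sup>2" by simp
  then have "(1 + norm (snd x) ^ 2) * (1 + norm (snd y) ^ 2) = (1 + snd x \<bullet> snd y)\<^sup>2"
    by (simp add: power_mult_distrib upper_sheet_fst[OF x] upper_sheet_fst[OF y])
  moreover have "norm (snd x - snd y) ^ 2 = norm (snd x) ^ 2 + norm (snd y) ^ 2 - 2 * (snd x \<bullet> snd y)"
    by (simp add: power2_norm_eq_inner inner_diff_left inner_diff_right inner_commute)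
  ultimately have "norm (snd x - snd y) ^ 2 + ((norm (snd x) * norm (snd y))\<^sup>2 - (snd x \<bullet> snd y)\<^sup>2) = 0"
    by (simp add: power2_eq_square algebra_simps)
  moreover have "(snd x \<bullet> snd y)\<^sup>2 \<le> (norm (snd x) * norm (snd y))\<^sup>2"
    using Cauchy_Schwarz_ineq[of "snd x" "snd y"]
    by (simp add: power_mult_distrib power2_norm_eq_inner)
  ultimately have "norm (snd x - snd y) ^ 2 \<le> 0"
    by linarith
  then have "snd x = snd y" by simp
  then have "fst x ^ 2 = fst y ^ 2" by (simp add: upper_sheet_fst x y)
  then have "fst x = fst y" using x y by (simp add: upper_sheet_def power2_eq_iff)
  then show ?thesis using \<open>snd x = snd y\<close> by (simp add: prod_eq_iff)
qed

lemma upper_sheet_dichotomy: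
  assumes "lorentz x x = -1"
  shows "x \<in> upper_sheet \<or> - x \<in> upper_sheet"
proof -
  have "lorentz (- x) (- x) = -1"
    using assms by (simp add: lorentz_inner)
  moreover have "fst x \<noteq> 0"
  proof
    assume "fst x = 0"
    then have "snd x \<bullet> snd x = -1" using assms by (simp add: lorentz_inner)
    then show False using inner_ge_zero[of "snd x"] by linarith
  qed
  ultimately show ?thesis using assms by (auto simp: upper_sheet_def)
qed

text \<open>The perpendicular bisector of two distinct points is the hyperplane orthogonal to \<open>x - y\<close>. Positivity
  of \<open>\<langle>x - y, x - y\<rangle>\<close>, which the reflection needs, is the strict form of \<open>\<langle>x, y\<rangle> \<le> -1\<close>.\<close>
lemma upper_sheet_reflection_swap:
  assumes x: "x \<in> upper_sheet" and y: "y \<in> upper_sheet" and "x \<noteq> y"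
  shows "lorentz (x - y) (x - y) > 0" "lorentz_reflection (x - y) x = y"
proof -
  have "lorentz x y < -1"
    using upper_sheet_lorentz_le[OF x y] upper_sheet_lorentz_eqD[OF x y] assms(3) by fastforce
  moreover have vv: "lorentz (x - y) (x - y) = - 2 - 2 * lorentz x y"
    using x y by (simp add: upper_sheet_def lorentz_diff_left lorentz_diff_right lorentz_sym[of y x])
  ultimately show pos: "lorentz (x - y) (x - y) > 0" by simp
  have "2 * lorentz (x - y) x = lorentz (x - y) (x - y)"
    unfolding vv using x by (simp add: upper_sheet_def lorentz_diff_left lorentz_sym[of y x])
  then show "lorentz_reflection (x - y) x = y"
    using pos by (simp add: lorentz_reflection_def)
qed

section \<open>The measure of separating hyperplanes\<close>

text \<open>A vector \<open>w\<close> of the shell \<open>0 < \<langle>w, w\<rangle> < 1\<close> stands for the hyperplane orthogonal to it. The two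
  conditions \<open>\<langle>x, w\<rangle> < 0\<close> and \<open>\<not> \<langle>x, w\<rangle> < 0\<close> are complementary, so points on the hyperplane are
  counted to one of its sides and each \<open>w\<close> is an honest cut; no null sets have to be discarded later.\<close>
definition separators :: "real \<times> (real ^ 'n::finite) \<Rightarrow> real \<times> (real ^ 'n) \<Rightarrow> (real \<times> (real ^ 'n)) set"
  where "separators x y =
    {w \<in> {w. 0 < lorentz w w \<and> lorentz w w < 1}. (lorentz x w < 0) \<noteq> (lorentz y w < 0)}"

definition crofton :: "real \<times> (real ^ 'n::finite) \<Rightarrow> real \<times> (real ^ 'n) \<Rightarrow> real"
  where "crofton x y = measure lborel (separators x y)"

lemma separators_borel [measurable]: "separators x y \<in> sets borel"
  unfolding separators_def by measurable

text \<open>If \<open>w\<close> is close to the light cone or beyond, in the sense that \<open>k \<parallel>snd w\<parallel> < \<bar>fst w\<bar>\<close>, then \<open>\<langle>x, w\<rangle>\<close>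
  and \<open>\<langle>y, w\<rangle>\<close> both have the sign of \<open>- fst w\<close>. Here \<open>k < 1\<close> is the larger slope \<open>\<parallel>snd z\<parallel> / fst z\<close> of
  the two points. A separating \<open>w\<close> therefore satisfies \<open>(1 - k\<^sup>2) \<parallel>snd w\<parallel>\<^sup>2 \<le> \<langle>w, w\<rangle> < 1\<close>.\<close>
lemma bounded_separators:
  assumes x: "x \<in> upper_sheet" and y: "y \<in> upper_sheet"
  shows "bounded (separators x y)"
proof -
  have px: "0 < fst x" and py: "0 < fst y" using x y by (auto simp: upper_sheet_def)
  define k where "k = max (norm (snd x) / fst x) (norm (snd y) / fst y)"
  have k0: "0 \<le> k" unfolding k_def using px by (simp add: le_max_iff_disj)
  have k1: "k < 1" unfolding k_def using px py upper_sheet_norm_less[OF x] upper_sheet_norm_less[OF y] by simp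
  then have kk: "0 < 1 - k\<^sup>2" using k0 by (simp add: power_less_one_iff abs_square_less_1)
  have sgn: "lorentz z w < 0 \<longleftrightarrow> 0 < fst w"
    if z: "z \<in> {x, y}" and w: "k * norm (snd w) < \<bar>fst w\<bar>" for z w
  proof -
    have pz: "0 < fst z" using z px py by auto
    have "norm (snd z) / fst z \<le> k" using z by (auto simp: k_def)
    then have "norm (snd z) \<le> k * fst z" using pz by (simp add: pos_divide_le_eq)
    then have "norm (snd z) * norm (snd w) \<le> k * fst z * norm (snd w)"
      by (rule mult_right_mono) simp
    also have "\<dots> < fst z * \<bar>fst w\<bar>"
      using mult_strict_left_mono[OF w pz] by (simp add: mult_ac)
    finally have "\<bar>snd z \<bullet> snd w\<bar> < fst z * \<bar>fst w\<bar>"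
      using Cauchy_Schwarz_ineq2[of "snd z" "snd w"] by linarith
    moreover have "0 < fst z * fst w \<longleftrightarrow> 0 < fst w" using pz by (simp add: zero_less_mult_iff)
    ultimately show ?thesis unfolding lorentz_inner
      by (cases "0 < fst w") (auto simp: abs_if split: if_splits)
  qed
  have "norm w \<le> 2 * sqrt (1 / (1 - k\<^sup>2))" if w: "w \<in> separators x y" for w
  proof -
    have a: "\<bar>fst w\<bar> \<le> k * norm (snd w)"
      using w sgn[of x w] sgn[of y w] by (fastforce simp: separators_def not_less[symmetric])
    then have "(fst w)\<^sup>2 \<le> (k * norm (snd w))\<^sup>2"
      using power_mono[of "\<bar>fst w\<bar>" _ 2] by simp
    moreover have "norm (snd w) ^ 2 - (fst w)\<^sup>2 < 1"
      using w unfolding power2_norm_eq_inner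
      by (simp add: separators_def lorentz_inner power2_eq_square)
    ultimately have "(1 - k\<^sup>2) * norm (snd w) ^ 2 \<le> 1"
      by (simp add: power_mult_distrib algebra_simps)
    then have "norm (snd w) ^ 2 \<le> 1 / (1 - k\<^sup>2)"
      using kk by (simp add: pos_le_divide_eq mult.commute)
    then have b: "norm (snd w) \<le> sqrt (1 / (1 - k\<^sup>2))"
      by (rule real_le_rsqrt)
    have "k * norm (snd w) \<le> 1 * norm (snd w)"
      using k1 by (intro mult_right_mono) auto
    then have "norm (fst w) \<le> sqrt (1 / (1 - k\<^sup>2))"
      using a b by simp
    then show ?thesis using norm_Pair_le[of "fst w" "snd w"] b by simp
  qed
  then show ?thesis unfolding bounded_iff by blast
qed

lemma fmeasurable_separators:
  assumes "x \<in> upper_sheet" "y \<in> upper_sheet"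
  shows "separators x y \<in> fmeasurable lborel"
  by (rule fmeasurableI) (use emeasure_bounded_finite[OF bounded_separators[OF assms]] in auto)

lemma crofton_nonneg: "0 \<le> crofton x y"
  by (simp add: crofton_def)

lemma crofton_sym: "crofton x y = crofton y x"
proof -
  have "separators x y = separators y x" by (auto simp: separators_def)
  then show ?thesis by (simp add: crofton_def)
qed

lemma crofton_triangle:
  assumes "x \<in> upper_sheet" "y \<in> upper_sheet" "z \<in> upper_sheet"
  shows "crofton x z \<le> crofton x y + crofton y z"
proof -
  have "separators x z \<subseteq> separators x y \<union> separators y z"
    by (auto simp: separators_def)
  then have "crofton x z \<le> measure lborel (separators x y \<union> separators y z)"
    unfolding crofton_def using assms
    by (intro measure_mono_fmeasurable fmeasurable.Un fmeasurable_separators) simp_all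
  also have "\<dots> \<le> crofton x y + crofton y z"
    unfolding crofton_def by (intro measure_Un_le) auto
  finally show ?thesis .
qed

text \<open>The point \<open>y\<close> lies on the geodesic segment from \<open>x\<close> to \<open>z\<close>. If \<open>x\<close> and \<open>z\<close> are on the same side of
  \<open>w\<close>, so is \<open>y\<close>; otherwise \<open>w\<close> separates \<open>y\<close> from exactly one of them.\<close>
lemma crofton_additive:
  assumes xyz: "x \<in> upper_sheet" "y \<in> upper_sheet" "z \<in> upper_sheet"
    and y: "y = a *\<^sub>R x + b *\<^sub>R z" and ab: "0 \<le> a" "0 \<le> b"
  shows "crofton x z = crofton x y + crofton y z"
proof -
  have ab0: "a \<noteq> 0 \<or> b \<noteq> 0" using y xyz by (auto simp: upper_sheet_def lorentz_inner)
  have L: "lorentz y w = a * lorentz x w + b * lorentz z w" for w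
    by (simp add: y lorentz_add_left)
  have neg: "lorentz y w < 0" if "lorentz x w < 0" "lorentz z w < 0" for w
  proof -
    have "a * lorentz x w \<le> 0" "b * lorentz z w \<le> 0"
      using that ab by (auto simp: mult_le_0_iff)
    moreover have "a * lorentz x w \<noteq> 0 \<or> b * lorentz z w \<noteq> 0"
      using that ab0 by auto
    ultimately show ?thesis unfolding L by linarith
  qed
  have nonneg: "\<not> lorentz y w < 0" if "\<not> lorentz x w < 0" "\<not> lorentz z w < 0" for w
    using that ab unfolding L by (simp add: not_less)
  have "separators x z = separators x y \<union> separators y z"
    using neg nonneg unfolding separators_def by blast
  moreover have "separators x y \<inter> separators y z = {}"
    using neg nonneg unfolding separators_def by blast
  ultimately show ?thesis
    unfolding crofton_def
    using measure_Un2[OF fmeasurable_separators[OF xyz(1,2)] fmeasurable_separators[OF xyz(2,3)]]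
    by (simp add: Diff_triv Int_commute)
qed

lemma crofton_reflection:
  assumes "lorentz v v \<noteq> 0"
  shows "crofton (lorentz_reflection v x) (lorentz_reflection v y) = crofton x y"
proof -
  let ?R = "lorentz_reflection v"
  note R = lorentz_reflection_isometry[OF assms]
  have "?R -` separators (?R x) (?R y) = separators x y"
    by (simp add: separators_def R)
  then show ?thesis
    using lborel_linear_involution[OF linear_lorentz_reflection lorentz_reflection_involution[OF assms]
        separators_borel, of "?R x" "?R y"]
    by (simp add: crofton_def measure_def)
qed

text \<open>Reflections preserve the form but might exchange the two sheets; this criterion keeps the image
  of a point on the upper sheet.\<close>
lemma upper_sheet_same_sheetI:
  assumes x: "x \<in> upper_sheet" and "lorentz y y = -1" and neg: "lorentz x y < 0"
  shows "y \<in> upper_sheet"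
proof (rule ccontr)
  assume "y \<notin> upper_sheet"
  then have "- y \<in> upper_sheet" using upper_sheet_dichotomy assms(2) by blast
  from upper_sheet_lorentz_neg[OF x this] neg show False by (simp add: lorentz_inner)
qed

section \<open>Two-point homogeneity\<close>

text \<open>If \<open>x\<close> is equidistant from \<open>y\<close> and \<open>z\<close>, it lies on their perpendicular bisector and is fixed by the
  reflection that takes \<open>y\<close> to \<open>z\<close>.\<close>
lemma crofton_cong_same_left:
  assumes "x \<in> upper_sheet" "y \<in> upper_sheet" "z \<in> upper_sheet" and eq: "lorentz x y = lorentz x z"
  shows "crofton x y = crofton x z"
proof (cases "y = z")
  case False
  note swap = upper_sheet_reflection_swap[OF assms(2,3) False]
  have "lorentz_reflection (y - z) x = x"
    by (simp add: lorentz_reflection_def lorentz_sym[of _ x] lorentz_diff_right eq)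
  then show ?thesis
    using crofton_reflection[of "y - z" x y] swap by simp
qed simp

text \<open>A first reflection takes \<open>x\<close> to \<open>x'\<close> and \<open>y\<close> to some \<open>z\<close>; a second one, fixing \<open>x'\<close>, takes \<open>z\<close> to \<open>y'\<close>.\<close>
lemma crofton_cong:
  fixes x y x' y' :: "real \<times> (real ^ 'n::finite)"
  assumes x: "x \<in> upper_sheet" and y: "y \<in> upper_sheet"
    and x': "x' \<in> upper_sheet" and y': "y' \<in> upper_sheet"
    and eq: "lorentz x y = lorentz x' y'"
  shows "crofton x y = crofton x' y'"
proof (cases "x = x'")
  case True
  then show ?thesis using crofton_cong_same_left assms by blast
next
  case False
  note swap = upper_sheet_reflection_swap[OF x x' False]
  define z where "z = lorentz_reflection (x - x') y"
  have iso: "lorentz z z = lorentz y y" "lorentz x' z = lorentz x y"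
    using lorentz_reflection_isometry[of "x - x'"] swap unfolding z_def by (metis less_irrefl)+
  have z: "z \<in> upper_sheet"
    using upper_sheet_same_sheetI[OF x', of z] iso y upper_sheet_lorentz_neg[OF x y]
    by (simp add: upper_sheet_def)
  have "crofton x y = crofton x' z"
    using crofton_reflection[of "x - x'" x y] swap by (simp add: z_def)
  also have "\<dots> = crofton x' y'"
    using crofton_cong_same_left[OF x' z y'] iso eq by simp
  finally show ?thesis .
qed

section \<open>The Crofton formula\<close>

text \<open>A unit-speed geodesic; \<open>undefined\<close> merely picks some coordinate axis, which exists because the index
  type is not empty.\<close>
definition geodesic_point :: "real \<Rightarrow> real \<times> (real ^ 'n::finite)"
  where "geodesic_point s = (cosh s, axis undefined (sinh s))"

lemma lorentz_geodesic_point: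
  "lorentz (geodesic_point s) (geodesic_point t :: real \<times> (real ^ 'n::finite)) = - cosh (s - t)"
  by (simp add: geodesic_point_def lorentz_inner inner_axis_axis cosh_diff)

lemma geodesic_point_upper_sheet: "geodesic_point s \<in> upper_sheet"
  by (simp add: upper_sheet_def lorentz_geodesic_point) (simp add: geodesic_point_def)

lemma crofton_geodesic_additive:
  assumes s: "0 \<le> s" and t: "0 \<le> t"
  shows "crofton (geodesic_point 0 :: real \<times> (real ^ 'n::finite)) (geodesic_point (s + t)) =
    crofton (geodesic_point 0 :: real \<times> (real ^ 'n)) (geodesic_point s)
    + crofton (geodesic_point 0 :: real \<times> (real ^ 'n)) (geodesic_point t)"
proof -
  let ?p = "geodesic_point :: real \<Rightarrow> real \<times> (real ^ 'n)"
  note H = geodesic_point_upper_sheet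
  have shift: "crofton (?p s) (?p (s + t)) = crofton (?p 0) (?p t)"
    by (rule crofton_cong) (simp_all add: H lorentz_geodesic_point)
  have self: "crofton x x = 0" for x :: "real \<times> (real ^ 'n)"
    by (simp add: crofton_def separators_def)
  show ?thesis
  proof (cases "s + t = 0")
    case True
    then show ?thesis using s t self by (simp add: add_nonneg_eq_0_iff)
  next
    case False
    then have pos: "sinh (s + t) > 0" using s t by simp
    have "sinh (s + t) * cosh s = sinh t + sinh s * cosh (s + t)"
      using sinh_diff[of "s + t" s] by (simp add: algebra_simps)
    then have c: "cosh s = sinh t / sinh (s + t) + sinh s / sinh (s + t) * cosh (s + t)"
      using pos by (simp add: field_simps)
    \<comment> \<open>Two vectors of the hyperboloid span the plane of their geodesic; the coefficients are those
      of spherical linear interpolation, with \<open>sinh\<close> in place of \<open>sin\<close>.\<close>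
    have "?p s = (sinh t / sinh (s + t)) *\<^sub>R ?p 0 + (sinh s / sinh (s + t)) *\<^sub>R ?p (s + t)"
      using c pos by (simp add: geodesic_point_def prod_eq_iff vec_eq_iff axis_def)
    from crofton_additive[OF H H H this] shift pos s t show ?thesis by simp
  qed
qed

lemma crofton_geodesic_pos: "0 < crofton (geodesic_point 0 :: real \<times> (real ^ 'n::finite)) (geodesic_point 1)"
proof -
  let ?p = "geodesic_point :: real \<Rightarrow> real \<times> (real ^ 'n)"
  define U where "U = {w. 0 < lorentz w w \<and> lorentz w w < 1 \<and> lorentz (?p 0) w < 0 \<and> 0 < lorentz (?p 1) w}"
  have "open U"
    unfolding U_def
    by (intro open_Collect_conj open_Collect_less continuous_on_lorentz continuous_on_const
        continuous_on_id)
  \<comment> \<open>The points \<open>0\<close> and \<open>1\<close> of the geodesic have slopes \<open>0\<close> and \<open>tanh 1\<close>; this vector is orthogonal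
    to a vector of slope \<open>tanh 1 / 2\<close>, between the two.\<close>
  moreover have "(tanh 1 / 4, axis undefined (1 / 2)) \<in> U"
  proof -
    have t: "0 < tanh (1::real)" "tanh (1::real) < 1" by (auto simp: tanh_real_lt_1)
    then have "tanh (1::real) * tanh 1 < 1 * 1" by (intro mult_strict_mono) auto
    moreover have "1 / 4 - tanh (1::real) * tanh 1 / 16 < 1"
      using zero_le_square[of "tanh (1::real)"] by linarith
    moreover have "cosh (1::real) * tanh 1 = sinh 1" by (simp add: tanh_def)
    ultimately show ?thesis using t
      by (simp add: U_def lorentz_inner geodesic_point_def inner_axis_axis)
  qed
  ultimately have "\<not> negligible U" using open_not_negligible by blast
  moreover have "U \<subseteq> separators (?p 0) (?p 1)" by (auto simp: U_def separators_def)
  ultimately have nn: "\<not> negligible (separators (?p 0) (?p 1))"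
    using negligible_subset by blast
  show ?thesis
  proof (rule ccontr)
    assume "\<not> ?thesis"
    then have "crofton (?p 0) (?p 1) = 0"
      using crofton_nonneg[of "?p 0" "?p 1"] by linarith
    then have "measure lborel (separators (?p 0) (?p 1)) = 0"
      unfolding crofton_def .
    then have "separators (?p 0) (?p 1) \<in> null_sets lborel"
      using emeasure_eq_measure2[OF fmeasurable_separators[of "?p 0" "?p 1"]]
      by (simp add: null_sets_def geodesic_point_upper_sheet)
    then show False using nn by (simp add: null_sets_completionI negligible_iff_null_sets)
  qed
qed

text \<open>By homogeneity \<open>x\<close> and \<open>y\<close> may be moved to the points \<open>0\<close> and \<open>s = arcosh (- \<langle>x, y\<rangle>)\<close> of the fixed
  geodesic, on which the measure is additive in \<open>s\<close>.\<close>
lemma crofton_eq_distance: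
  fixes x y :: "real \<times> (real ^ 'n::finite)"
  assumes x: "x \<in> upper_sheet" and y: "y \<in> upper_sheet"
  shows "crofton x y = arcosh (- lorentz x y)
    * crofton (geodesic_point 0 :: real \<times> (real ^ 'n)) (geodesic_point 1)"
proof -
  let ?p = "geodesic_point :: real \<Rightarrow> real \<times> (real ^ 'n)"
  have ge: "1 \<le> - lorentz x y" using upper_sheet_lorentz_le[OF x y] by simp
  have "crofton x y = crofton (?p 0) (?p (arcosh (- lorentz x y)))"
    by (rule crofton_cong)
      (use x y ge in \<open>simp_all add: geodesic_point_upper_sheet lorentz_geodesic_point\<close>)
  also have "\<dots> = arcosh (- lorentz x y) * crofton (?p 0) (?p 1)"
    by (rule additive_nonneg_linear[where F = "\<lambda>s. crofton (?p 0) (?p s)"])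
      (use ge in \<open>simp_all add: crofton_geodesic_additive crofton_nonneg\<close>)
  finally show ?thesis .
qed

section \<open>Hyperbolic space as a set of lines\<close>

lemma hyperbolic_space_representative:
  assumes "X \<in> hyperbolic_space"
  obtains x where "x \<in> upper_sheet" "X = proj_class x"
proof -
  obtain z where z: "lorentz z z < 0" "X = proj_class z"
    using assms by (auto simp: hyperbolic_space_def)
  define c where "c = 1 / sqrt (- lorentz z z)"
  have c: "c > 0" "c\<^sup>2 = 1 / (- lorentz z z)"
    using z by (simp_all add: c_def power_divide)
  have z0: "z \<noteq> 0" using z by (auto simp: lorentz_inner)
  have cls: "proj_class (a *\<^sub>R z) = X" if "a \<noteq> 0" for a
    unfolding z using Quotient3_rel[OF Quotient3_projective_space, of "a *\<^sub>R z" z] z0 that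
    by (auto intro!: exI[of _ "1::real"] exI[of _ "inverse a"])
  have "lorentz (c *\<^sub>R z) (c *\<^sub>R z) = c\<^sup>2 * lorentz z z" by (simp add: power2_eq_square)
  also have "\<dots> = -1" using c z by simp
  finally have "c *\<^sub>R z \<in> upper_sheet \<or> (- c) *\<^sub>R z \<in> upper_sheet"
    using upper_sheet_dichotomy by fastforce
  then show thesis
    using that[of "c *\<^sub>R z"] that[of "(- c) *\<^sub>R z"] cls[of c] cls[of "- c"] c(1) by fastforce
qed

lemma geodesic_dist_upper_sheet:
  assumes x: "x \<in> upper_sheet" and y: "y \<in> upper_sheet"
  shows "geodesic_dist (proj_class x) (proj_class y) = arcosh (- lorentz x y)"
proof -
  have n: "lorentz x x = -1" "lorentz y y = -1" using x y by (auto simp: upper_sheet_def)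
  have "cosh (geodesic_dist (proj_class x) (proj_class y)) = - lorentz x y"
    using cosh_geodesic_dist(1)[of x y] n upper_sheet_lorentz_neg[OF x y] by simp
  moreover have "0 \<le> geodesic_dist (proj_class x) (proj_class y)"
    using cosh_geodesic_dist(2)[of x y] n by simp
  ultimately show ?thesis by (metis arcosh_cosh_real)
qed

theorem corollary3p1:
  "hypermetric_on (hyperbolic_space :: ('n::finite) projective_space set) geodesic_dist"
proof -
  define r :: "'n projective_space \<Rightarrow> real \<times> (real ^ 'n)"
    where "r X = (SOME x. x \<in> upper_sheet \<and> X = proj_class x)" for X
  have r: "r X \<in> upper_sheet \<and> X = proj_class (r X)" if "X \<in> hyperbolic_space" for X
    unfolding r_def by (rule someI_ex) (use hyperbolic_space_representative[OF that] in blast)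
  define c where "c = 1 / crofton (geodesic_point 0 :: real \<times> (real ^ 'n)) (geodesic_point 1)"
  have c: "0 < c" using crofton_geodesic_pos by (simp add: c_def)
  have d: "geodesic_dist X Y = c * crofton (r X) (r Y)"
    if "X \<in> hyperbolic_space" "Y \<in> hyperbolic_space" for X Y :: "'n projective_space"
    using geodesic_dist_upper_sheet[of "r X" "r Y"] crofton_eq_distance[of "r X" "r Y"]
      r[OF that(1)] r[OF that(2)] c by (simp add: c_def)
  have "semimetric_on (hyperbolic_space :: 'n projective_space set) geodesic_dist"
    unfolding semimetric_on_def
  proof (intro conjI ballI)
    fix X Y Z :: "'n projective_space"
    assume X: "X \<in> hyperbolic_space"
    then show "geodesic_dist X X = 0"
      by (simp add: d crofton_def separators_def)
    assume Y: "Y \<in> hyperbolic_space"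
    show "0 \<le> geodesic_dist X Y" "geodesic_dist X Y = geodesic_dist Y X"
      using X Y c by (simp_all add: d crofton_nonneg crofton_sym)
    assume Z: "Z \<in> hyperbolic_space"
    show "geodesic_dist X Z \<le> geodesic_dist X Y + geodesic_dist Y Z"
      using X Y Z c crofton_triangle[of "r X" "r Y" "r Z"] r
      by (simp add: d distrib_left[symmetric])
  qed
  moreover have "(\<Sum>X\<in>S. \<Sum>Y\<in>S. of_int (t X) * of_int (t Y) * geodesic_dist X Y) \<le> 0"
    if S: "finite S" "S \<subseteq> hyperbolic_space" and t: "(\<Sum>X\<in>S. t X) = (1::int)"
    for S :: "'n projective_space set" and t
  proof -
    have "(\<Sum>X\<in>S. \<Sum>Y\<in>S. of_int (t X) * of_int (t Y) * geodesic_dist X Y)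
        = c * (\<Sum>X\<in>S. \<Sum>Y\<in>S. of_int (t X) * of_int (t Y) * crofton (r X) (r Y))"
      unfolding sum_distrib_left using S by (intro sum.cong refl) (simp add: d subset_iff)
    also have "(\<Sum>X\<in>S. \<Sum>Y\<in>S. of_int (t X) * of_int (t Y) * crofton (r X) (r Y)) \<le> 0"
      unfolding crofton_def separators_def
      by (rule sum_cut_measure_nonpos[OF S(1) t])
        (use S r fmeasurable_separators[unfolded separators_def] in blast)
    finally show ?thesis using c by (simp add: mult_le_0_iff)
  qed
  ultimately show ?thesis unfolding hypermetric_on_def by blast
qed

end
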